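(* Let $K$ be a field, let $I$ and $J$ be monomial ideals in $R=K[x_1,\ldots,x_n]$, and let $W$ be a weight over $R$. Then $J$ is a demotion of $I$ if and only if $J_W$ is a demotion of $I_W$, where $I_W$ and $J_W$ denote the weighted ideals.
   Context: For ideals $J\subseteq I$ in a commutative Noetherian ring $R$, $J$ is a demotion of $I$ if $I^rJ^s=I^{r+s}\cap J^s$ for all integers $r,s\geq 0$ (with $I^0=J^0=R$); being a demotion includes the containment $J\subseteq I$. A weight over $R=K[x_1,\ldots,x_n]$ is a function $W$ from $\{x_1,\ldots,x_n\}$ to the positive integers; $w_i=W(x_i)$ is the weight of $x_i$. For a monomial ideal $I\subset R$ with minimal set of monomial generators $\mathcal{G}(I)$, the weighted ideal $I_W$ is the ideal of $R$ generated by $\{h(u): u\in\mathcal{G}(I)\}$, where $h:R\to R$ is the unique $K$-algebra homomorphism with $h(x_i)=x_i^{w_i}$. *)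

theory Defs
  imports Complex_Main "HOL-Library.Poly_Mapping"
begin

section \<open>Ideals and demotions in commutative rings\<close>

text \<open>
  An ideal of \<open>R\<close> is an \<open>R\<close>-submodule of \<open>R\<close>; the ring is the whole type.
\<close>

definition is_ideal :: "'a::comm_ring_1 set \<Rightarrow> bool" where
  "is_ideal I \<longleftrightarrow> module.subspace (*) I"

definition ideal_gen :: "'a::comm_ring_1 set \<Rightarrow> 'a set" where
  "ideal_gen S = module.span (*) S"

definition ideal_mult :: "'a::comm_ring_1 set \<Rightarrow> 'a set \<Rightarrow> 'a set" where
  "ideal_mult I J = ideal_gen {a * b | a b. a \<in> I \<and> b \<in> J}"

primrec ideal_pow :: "'a::comm_ring_1 set \<Rightarrow> nat \<Rightarrow> 'a set" where
  "ideal_pow I 0 = UNIV"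
| "ideal_pow I (Suc r) = ideal_mult I (ideal_pow I r)"

text \<open>
  \<open>demotion J I\<close> means that \<open>J\<close> is a demotion of \<open>I\<close>.  The definition makes sense in every
  commutative ring, so the ring is not required to be Noetherian here; a polynomial ring in
  finitely many variables over a field is Noetherian anyway.
\<close>

definition demotion :: "'a::comm_ring_1 set \<Rightarrow> 'a set \<Rightarrow> bool" where
  "demotion J I \<longleftrightarrow> is_ideal I \<and> is_ideal J \<and> J \<subseteq> I \<and>
     (\<forall>r s. ideal_mult (ideal_pow I r) (ideal_pow J s) = ideal_pow I (r + s) \<inter> ideal_pow J s)"


section \<open>Monomial ideals in a polynomial ring\<close>

text \<open>
  The polynomial ring over \<open>'k\<close> with variables indexed by \<open>'n\<close>: finitely supported functions from
  exponent vectors to coefficients, with the convolution product.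
\<close>

type_synonym ('n, 'k) mpoly = "('n \<Rightarrow>\<^sub>0 nat) \<Rightarrow>\<^sub>0 'k"

definition Const :: "'k \<Rightarrow> ('n, 'k::comm_ring_1) mpoly" where
  "Const c = Poly_Mapping.single 0 c"

definition Var :: "'n \<Rightarrow> ('n, 'k::comm_ring_1) mpoly" where
  "Var i = Poly_Mapping.single (Poly_Mapping.single i 1) 1"

definition monomials :: "('n, 'k::comm_ring_1) mpoly set" where
  "monomials = range (\<lambda>a. Poly_Mapping.single a 1)"

definition monomial_ideal :: "('n, 'k::comm_ring_1) mpoly set \<Rightarrow> bool" where
  "monomial_ideal I \<longleftrightarrow> (\<exists>S \<subseteq> monomials. I = ideal_gen S)"

definition is_min_mono_gens :: "('n, 'k::comm_ring_1) mpoly set \<Rightarrow> ('n, 'k) mpoly set \<Rightarrow> bool" where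
  "is_min_mono_gens I G \<longleftrightarrow> G \<subseteq> monomials \<and> ideal_gen G = I \<and> (\<forall>G' \<subset> G. ideal_gen G' \<noteq> I)"

text \<open>Well defined for monomial ideals by \<open>ex1_min_mono_gens\<close> below.\<close>

definition min_mono_gens :: "('n, 'k::comm_ring_1) mpoly set \<Rightarrow> ('n, 'k) mpoly set" where
  "min_mono_gens I = (THE G. is_min_mono_gens I G)"


section \<open>Weighted ideals\<close>

definition is_weight :: "('n \<Rightarrow> nat) \<Rightarrow> bool" where
  "is_weight W \<longleftrightarrow> (\<forall>i. 0 < W i)"

definition algebra_hom :: "(('n, 'k::comm_ring_1) mpoly \<Rightarrow> ('n, 'k) mpoly) \<Rightarrow> bool" where
  "algebra_hom h \<longleftrightarrow> (\<forall>f g. h (f + g) = h f + h g) \<and> (\<forall>f g. h (f * g) = h f * h g) \<and>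
     (\<forall>c. h (Const c) = Const c)"

text \<open>Well defined by \<open>ex1_weight_hom\<close> below.\<close>

definition weight_hom :: "('n \<Rightarrow> nat) \<Rightarrow> ('n, 'k::comm_ring_1) mpoly \<Rightarrow> ('n, 'k) mpoly" where
  "weight_hom W = (THE h. algebra_hom h \<and> (\<forall>i. h (Var i) = Var i ^ W i))"

definition weighted_ideal ::
    "('n \<Rightarrow> nat) \<Rightarrow> ('n, 'k::comm_ring_1) mpoly set \<Rightarrow> ('n, 'k) mpoly set" where
  "weighted_ideal W I = ideal_gen (weight_hom W ` min_mono_gens I)"


section \<open>The definite descriptions above are well defined\<close>

interpretation ideal: module "(*) :: 'a::comm_ring_1 \<Rightarrow> 'a \<Rightarrow> 'a"
  by standard (simp_all add: algebra_simps)

lemma poly_mapping_sum_single: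
  fixes f :: "'a \<Rightarrow>\<^sub>0 'b::comm_monoid_add"
  shows "f = (\<Sum>a\<in>Poly_Mapping.keys f. Poly_Mapping.single a (Poly_Mapping.lookup f a))"
  by (rule poly_mapping_eqI)
    (simp add: lookup_sum lookup_single when_def in_keys_iff sum.delta)

lemma single_one_eq_iff:
  "Poly_Mapping.single a (1::'k::zero_neq_one) = Poly_Mapping.single b 1 \<longleftrightarrow> a = b"
  by (metis keys_single singleton_inject zero_neq_one)

lemma poly_mapping_single_induct [case_names zero single add]:
  fixes f :: "'a \<Rightarrow>\<^sub>0 'b::comm_monoid_add"
  assumes "P 0" "\<And>a c. P (Poly_Mapping.single a c)" "\<And>f g. P f \<Longrightarrow> P g \<Longrightarrow> P (f + g)"
  shows "P f"
proof -
  have "P (\<Sum>a\<in>A. Poly_Mapping.single a (Poly_Mapping.lookup f a))" if "finite A" for A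
    using that by (induction A) (auto intro: assms)
  then show ?thesis
    by (subst poly_mapping_sum_single) simp
qed

lemma keys_ideal_gen_monomials:
  assumes "S \<subseteq> monomials" "f \<in> ideal_gen S" "c \<in> Poly_Mapping.keys f"
  shows "\<exists>a b. Poly_Mapping.single a 1 \<in> S \<and> c = a + b"
proof -
  have "\<forall>c\<in>Poly_Mapping.keys f. \<exists>a b. Poly_Mapping.single a 1 \<in> S \<and> c = a + b"
    using assms(2) unfolding ideal_gen_def
  proof (induction rule: ideal.span_induct_alt)
    case base
    then show ?case by simp
  next
    case (step p x y)
    show ?case
    proof
      fix c assume "c \<in> Poly_Mapping.keys (p * x + y)"
      then consider "c \<in> Poly_Mapping.keys (p * x)" | "c \<in> Poly_Mapping.keys y"
        using Poly_Mapping.keys_add[of "p * x" y] by blast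
      then show "\<exists>a b. Poly_Mapping.single a 1 \<in> S \<and> c = a + b"
      proof cases
        case 1
        obtain a where x: "x = Poly_Mapping.single a 1"
          using step(1) assms(1) by (auto simp: monomials_def)
        then obtain b where "c = b + a"
          using 1 keys_mult[of p x] by (auto split: if_splits)
        then show ?thesis
          using x step(1) by (metis add.commute)
      next
        case 2
        then show ?thesis using step by blast
      qed
    qed
  qed
  then show ?thesis using assms(3) by blast
qed

lemma single_in_ideal_gen:
  assumes "Poly_Mapping.single a (1::'k::comm_ring_1) \<in> ideal_gen S"
  shows "Poly_Mapping.single (a + b) 1 \<in> ideal_gen S"
proof -
  have "Poly_Mapping.single b 1 * Poly_Mapping.single a (1::'k) \<in> ideal_gen S"
    using assms unfolding ideal_gen_def by (rule ideal.span_scale)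
  then show ?thesis by (simp add: mult_single add.commute)
qed

lemma ideal_gen_base: "x \<in> S \<Longrightarrow> x \<in> ideal_gen S"
  by (simp add: ideal_gen_def ideal.span_base)

lemma ideal_gen_eqI:
  assumes "A \<subseteq> B" "B \<subseteq> ideal_gen A"
  shows "ideal_gen A = ideal_gen B"
proof
  show "ideal_gen A \<subseteq> ideal_gen B"
    using assms(1) unfolding ideal_gen_def by (rule ideal.span_mono)
  show "ideal_gen B \<subseteq> ideal_gen A"
    using assms(2) ideal.subspace_span unfolding ideal_gen_def by (rule ideal.span_minimal)
qed

lemma min_mono_gens_unique:
  fixes G H :: "('n, 'k::field) mpoly set"
  assumes G: "is_min_mono_gens I G" and H: "is_min_mono_gens I H"
  shows "G \<subseteq> H"
proof
  fix u assume u: "u \<in> G"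
  have GH: "G \<subseteq> monomials" "H \<subseteq> monomials" "ideal_gen G = I" "ideal_gen H = I"
    using G H by (auto simp: is_min_mono_gens_def)
  obtain c where c: "u = Poly_Mapping.single c 1"
    using u GH by (auto simp: monomials_def)
  have "u \<in> ideal_gen H"
    using u GH ideal_gen_base by blast
  then obtain a b where a: "Poly_Mapping.single a 1 \<in> H" "c = a + b"
    using keys_ideal_gen_monomials[of H u c] GH c by auto
  have "Poly_Mapping.single a 1 \<in> ideal_gen G"
    using a GH ideal_gen_base by blast
  then obtain d e where d: "Poly_Mapping.single d 1 \<in> G" "a = d + e"
    using keys_ideal_gen_monomials[of G "Poly_Mapping.single a 1" a] GH by auto
  have "d = c"
  proof (rule ccontr)
    assume "d \<noteq> c"
    then have "Poly_Mapping.single d 1 \<in> ideal_gen (G - {u})"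
      using d c by (intro ideal_gen_base) (auto simp: single_one_eq_iff)
    then have "Poly_Mapping.single (d + (e + b)) 1 \<in> ideal_gen (G - {u})"
      by (rule single_in_ideal_gen)
    then have "u \<in> ideal_gen (G - {u})"
      using a d c by (simp add: add.assoc)
    moreover have "G - {u} \<subseteq> ideal_gen (G - {u})"
      by (auto intro: ideal_gen_base)
    ultimately have "G \<subseteq> ideal_gen (G - {u})"
      by auto
    then have "ideal_gen (G - {u}) = ideal_gen G"
      by (intro ideal_gen_eqI) auto
    then show False
      using G u by (auto simp: is_min_mono_gens_def)
  qed
  then have "c = c + (e + b)"
    using a d by (simp add: add.assoc)
  then have "e + b = 0"
    by simp
  then have "b = 0"
    by (metis add_eq_0_iff_both_eq_0 lookup_add lookup_zero poly_mapping_eqI)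
  then show "u \<in> H" using a c by simp
qed

theorem ex1_min_mono_gens:
  fixes I :: "('n::finite, 'k::field) mpoly set"
  assumes "monomial_ideal I"
  shows "\<exists>!G. is_min_mono_gens I G"
proof -
  obtain S where S: "S \<subseteq> monomials" "I = ideal_gen S"
    using assms by (auto simp: monomial_ideal_def)
  define A where "A = {a. Poly_Mapping.single a (1::'k) \<in> S}"
  define M where "M = {c \<in> A. \<forall>a\<in>A. \<forall>b. c = a + b \<longrightarrow> b = 0}"
  define G where "G = (\<lambda>a. Poly_Mapping.single a (1::'k)) ` M"
  have GS: "G \<subseteq> S" "G \<subseteq> monomials"
    by (auto simp: G_def M_def A_def monomials_def)
  have gen: "Poly_Mapping.single a 1 \<in> ideal_gen G" if "a \<in> A" for a
    using that
  proof (induction "\<Sum>i\<in>UNIV. Poly_Mapping.lookup a i" arbitrary: a rule: less_induct)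
    case less
    show ?case
    proof (cases "a \<in> M")
      case True
      then show ?thesis by (auto simp: G_def intro: ideal_gen_base)
    next
      case False
      then obtain d b where d: "d \<in> A" "a = d + b" "b \<noteq> 0"
        using less by (auto simp: M_def)
      obtain i where "Poly_Mapping.lookup b i \<noteq> 0"
        using d(3) by (metis lookup_zero poly_mapping_eqI)
      then have "(\<Sum>i\<in>UNIV. Poly_Mapping.lookup b i) > 0"
        by (simp add: sum_pos2)
      then have "(\<Sum>i\<in>UNIV. Poly_Mapping.lookup d i) < (\<Sum>i\<in>UNIV. Poly_Mapping.lookup a i)"
        by (simp add: d lookup_add sum.distrib)
      then show ?thesis
        using less(1) d single_in_ideal_gen by blast
    qed
  qed
  have "S \<subseteq> ideal_gen G"
    using S gen by (auto simp: A_def monomials_def)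
  then have "ideal_gen G = I"
    using ideal_gen_eqI[OF GS(1)] S(2) by simp
  moreover have "ideal_gen G' \<noteq> I" if G': "G' \<subset> G" for G'
  proof
    assume gI: "ideal_gen G' = I"
    obtain c where c: "c \<in> M" "Poly_Mapping.single c 1 \<notin> G'"
      using G' by (auto simp: G_def)
    have "Poly_Mapping.single c 1 \<in> ideal_gen G'"
      unfolding gI S(2) using c by (intro ideal_gen_base) (auto simp: M_def A_def)
    moreover have "G' \<subseteq> monomials"
      using G' GS by blast
    ultimately obtain a b where a: "Poly_Mapping.single a 1 \<in> G'" "c = a + b"
      using keys_ideal_gen_monomials[of G' "Poly_Mapping.single c 1" c] by auto
    then have "a \<in> A"
      using G' GS by (auto simp: A_def)
    then have "b = 0"
      using a c by (auto simp: M_def)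
    then show False using a c by simp
  qed
  ultimately have "is_min_mono_gens I G"
    using GS by (simp add: is_min_mono_gens_def)
  then show ?thesis
    using min_mono_gens_unique by (metis subset_antisym)
qed

lemma single_eq_Const_mult:
  "Poly_Mapping.single a c = Const c * Poly_Mapping.single a (1::'k::comm_ring_1)"
  by (simp add: Const_def mult_single)

lemma Var_power: "Var i ^ k = Poly_Mapping.single (Poly_Mapping.single i k) (1::'k::comm_ring_1)"
  by (induction k) (simp_all add: Var_def mult_single flip: single_add)

lemma algebra_hom_eqI:
  fixes g h :: "('n, 'b::comm_ring_1) mpoly \<Rightarrow> ('n, 'b) mpoly"
  assumes g: "algebra_hom g" and h: "algebra_hom h" and Var: "\<And>i. g (Var i) = h (Var i)"
  shows "g = h"
proof
  fix f
  have one: "g 1 = h 1"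
  proof -
    have "g (Const 1) = h (Const 1)"
      using g h by (simp add: algebra_hom_def)
    then show ?thesis by (simp add: Const_def)
  qed
  have pow: "g (Var i ^ k) = h (Var i ^ k)" for i k
    by (induction k) (use g h Var one in \<open>simp_all add: algebra_hom_def\<close>)
  have mono: "g (Poly_Mapping.single a 1) = h (Poly_Mapping.single a 1)" for a
  proof (induction a rule: poly_mapping_single_induct)
    case zero
    then show ?case using one by simp
  next
    case (single i k)
    then show ?case using pow by (simp add: Var_power)
  next
    case (add a b)
    have "Poly_Mapping.single (a + b) (1::'b) = Poly_Mapping.single a 1 * Poly_Mapping.single b 1"
      by (simp add: mult_single)
    then show ?case using add g h by (simp add: algebra_hom_def)
  qed
  show "g f = h f"
  proof (induction f rule: poly_mapping_single_induct)
    case zero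
    have "g (Const 0) = h (Const 0)"
      using g h by (simp add: algebra_hom_def)
    then show ?case by (simp add: Const_def)
  next
    case (single a c)
    then show ?case
      using g h mono by (subst (1 2) single_eq_Const_mult) (simp add: algebra_hom_def)
  next
    case (add f1 f2)
    then show ?case using g h by (simp add: algebra_hom_def)
  qed
qed

theorem ex1_weight_hom:
  fixes W :: "'n \<Rightarrow> nat"
  shows "\<exists>!h :: ('n, 'k::comm_ring_1) mpoly \<Rightarrow> ('n, 'k) mpoly.
           algebra_hom h \<and> (\<forall>i. h (Var i) = Var i ^ W i)"
proof -
  define e :: "('n \<Rightarrow>\<^sub>0 nat) \<Rightarrow> ('n \<Rightarrow>\<^sub>0 nat)" where
    "e a = Poly_Mapping.mapp (\<lambda>i k. W i * k) a" for a
  have lookup_e: "Poly_Mapping.lookup (e a) i = W i * Poly_Mapping.lookup a i" for a i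
    by (simp add: e_def lookup_mapp when_def in_keys_iff)
  have e_add: "e (a + b) = e a + e b" for a b
    by (rule poly_mapping_eqI) (simp add: lookup_e lookup_add algebra_simps)
  have e_0: "e 0 = 0"
    by (rule poly_mapping_eqI) (simp add: lookup_e)
  have e_single: "e (Poly_Mapping.single i k) = Poly_Mapping.single i (W i * k)" for i k
    by (rule poly_mapping_eqI) (simp add: lookup_e lookup_single when_def)
  define h :: "('n, 'k) mpoly \<Rightarrow> ('n, 'k) mpoly" where
    "h f = (\<Sum>a\<in>Poly_Mapping.keys f. Poly_Mapping.single (e a) (Poly_Mapping.lookup f a))" for f
  have h_add: "h (f + g) = h f + h g" for f g
    unfolding h_def by (rule setsum_keys_plus_distrib) (simp_all add: single_add)
  have h_single: "h (Poly_Mapping.single a c) = Poly_Mapping.single (e a) c" for a c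
    by (simp add: h_def)
  have h_0: "h 0 = 0"
    by (simp add: h_def)
  have h_mult1: "h (Poly_Mapping.single a c * g) = h (Poly_Mapping.single a c) * h g" for a c g
    by (induction g rule: poly_mapping_single_induct)
      (simp_all add: h_0 h_add h_single mult_single e_add distrib_left)
  have h_mult: "h (f * g) = h f * h g" for f g
    by (induction f rule: poly_mapping_single_induct)
      (simp_all add: h_0 h_add h_mult1 distrib_right)
  have "algebra_hom h"
    by (simp add: algebra_hom_def h_add h_mult Const_def h_single e_0)
  moreover have "h (Var i) = Var i ^ W i" for i
    unfolding Var_power by (simp add: Var_def h_single e_single)
  ultimately have "algebra_hom h \<and> (\<forall>i. h (Var i) = Var i ^ W i)"
    by blast
  then show ?thesis
  proof (rule ex1I[of _ h])
    fix g :: "('n, 'k) mpoly \<Rightarrow> ('n, 'k) mpoly"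
    assume "algebra_hom g \<and> (\<forall>i. g (Var i) = Var i ^ W i)"
    then show "g = h"
      using \<open>algebra_hom h \<and> _\<close> by (intro algebra_hom_eqI) simp_all
  qed
qed

end

theory Submission
  imports Defs "HOL-Library.Set_Algebras"
begin

text \<open>
  A monomial ideal is the same thing as the set \<open>X\<close> of exponent vectors of the monomials in it, and
  such a set is one that is closed under adding arbitrary exponent vectors.  In this dictionary
  (\<open>demotion_monomial_span_iff\<close>) products of ideals become Minkowski sums and intersections become
  intersections, so that being a demotion becomes a family of equations between sets of exponent
  vectors built with \<open>+\<close> and \<open>\<inter>\<close>.

  Raising each variable to its weight multiplies the coordinates of exponent vectors by the weights.
  Coordinatewise rounded division by the weights, \<open>c \<mapsto> \<lfloor>c / W\<rfloor>\<close>, is adjoint to this scaling: a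
  monomial with exponent \<open>c\<close> is divisible by \<open>h(x^a)\<close> iff \<open>x^a\<close> divides the monomial with exponent
  \<open>\<lfloor>c / W\<rfloor>\<close>.  Hence the exponent set of the weighted ideal is the preimage of \<open>X\<close> under the
  rounded division (\<open>weighted_ideal_monomial_span\<close>).  Taking preimages under a surjection reflects
  equality and inclusion and commutes with intersections.  It also commutes with Minkowski sums
  here (\<open>vimage_exp_div_plus\<close>), although rounded division is only superadditive, because the sets
  involved are closed upwards.  So the equations for \<open>J\<close> and \<open>I\<close> hold iff those for the
  weighted ideals hold.
\<close>

section \<open>Monomial ideals as sets of exponent vectors\<close>

definition up_closed :: "'a::plus set \<Rightarrow> bool" where
  "up_closed X \<longleftrightarrow> (\<forall>a\<in>X. \<forall>b. a + b \<in> X)"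

definition monomial_span :: "('n \<Rightarrow>\<^sub>0 nat) set \<Rightarrow> ('n, 'k::comm_ring_1) mpoly set" where
  "monomial_span X = {f. Poly_Mapping.keys f \<subseteq> X}"

lemma up_closed_UNIV: "up_closed UNIV"
  by (simp add: up_closed_def)

lemma up_closed_plus:
  fixes X Y :: "'a::comm_monoid_add set"
  assumes "up_closed Y"
  shows "up_closed (X + Y)"
  unfolding up_closed_def
proof (intro ballI allI)
  fix c d assume "c \<in> X + Y"
  then obtain a b where "a \<in> X" "b \<in> Y" "c = a + b"
    by (auto simp: set_plus_def)
  moreover from this have "b + d \<in> Y"
    using assms by (simp add: up_closed_def)
  ultimately show "c + d \<in> X + Y"
    by (auto simp: add.assoc intro: set_plus_intro)
qed

lemma up_closed_plus_UNIV: "up_closed X \<Longrightarrow> X + UNIV = (X :: 'a::comm_monoid_add set)"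
proof (intro subset_antisym subsetI)
  fix a assume "a \<in> X"
  then have "a + 0 \<in> X + UNIV"
    by (intro set_plus_intro UNIV_I)
  then show "a \<in> X + UNIV"
    by simp
qed (auto simp: up_closed_def set_plus_def)

lemma single_one_in_monomial_span_iff:
  "Poly_Mapping.single a (1::'k::comm_ring_1) \<in> monomial_span X \<longleftrightarrow> a \<in> X"
  by (simp add: monomial_span_def)

lemma monomial_span_subset_iff:
  "(monomial_span X :: ('n, 'k::comm_ring_1) mpoly set) \<subseteq> monomial_span Y \<longleftrightarrow> X \<subseteq> Y"
proof
  assume "(monomial_span X :: ('n, 'k) mpoly set) \<subseteq> monomial_span Y"
  then show "X \<subseteq> Y"
    by (metis single_one_in_monomial_span_iff subset_iff)
qed (auto simp: monomial_span_def)

lemma monomial_span_eq_iff: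
  "(monomial_span X :: ('n, 'k::comm_ring_1) mpoly set) = monomial_span Y \<longleftrightarrow> X = Y"
  by (simp add: set_eq_subset monomial_span_subset_iff)

lemma monomial_span_Int: "monomial_span (X \<inter> Y) = monomial_span X \<inter> monomial_span Y"
  by (auto simp: monomial_span_def)

lemma monomial_span_UNIV: "monomial_span UNIV = UNIV"
  by (simp add: monomial_span_def)

lemma ideal_gen_single_image:
  "ideal_gen ((\<lambda>a. Poly_Mapping.single a (1::'k::comm_ring_1)) ` A) = monomial_span (A + UNIV)"
    (is "ideal_gen ?S = _")
proof
  show "ideal_gen ?S \<subseteq> monomial_span (A + UNIV)"
  proof
    fix f assume f: "f \<in> ideal_gen ?S"
    have S: "?S \<subseteq> monomials"
      by (auto simp: monomials_def)
    have "c \<in> A + UNIV" if "c \<in> Poly_Mapping.keys f" for c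
    proof -
      obtain a b where "Poly_Mapping.single a 1 \<in> ?S" "c = a + b"
        using keys_ideal_gen_monomials[OF S f \<open>c \<in> _\<close>] by blast
      then show ?thesis
        by (auto simp: single_one_eq_iff set_plus_def)
    qed
    then show "f \<in> monomial_span (A + UNIV)"
      by (auto simp: monomial_span_def)
  qed
  show "monomial_span (A + UNIV) \<subseteq> ideal_gen ?S"
  proof
    fix f :: "('a, 'k) mpoly"
    assume f: "f \<in> monomial_span (A + UNIV)"
    have "Poly_Mapping.single c (Poly_Mapping.lookup f c) \<in> ideal_gen ?S"
      if c: "c \<in> Poly_Mapping.keys f" for c
    proof -
      obtain a b where "a \<in> A" "c = a + b"
        using f c by (auto simp: monomial_span_def set_plus_def)
      then have "Poly_Mapping.single c 1 \<in> ideal_gen ?S"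
        by (auto intro: single_in_ideal_gen ideal_gen_base)
      then show ?thesis
        unfolding single_eq_Const_mult[of c "Poly_Mapping.lookup f c"] ideal_gen_def
        by (rule ideal.span_scale)
    qed
    then have "(\<Sum>c\<in>Poly_Mapping.keys f. Poly_Mapping.single c (Poly_Mapping.lookup f c))
        \<in> ideal_gen ?S"
      unfolding ideal_gen_def by (intro ideal.span_sum)
    then show "f \<in> ideal_gen ?S"
      by (simp flip: poly_mapping_sum_single)
  qed
qed

lemma ideal_gen_monomialsE:
  assumes "S \<subseteq> (monomials :: ('n, 'k::comm_ring_1) mpoly set)"
  obtains A where "S = (\<lambda>a. Poly_Mapping.single a (1::'k)) ` A"
    and "ideal_gen S = monomial_span (A + UNIV)"
proof -
  obtain A where A: "S = (\<lambda>a. Poly_Mapping.single a (1::'k)) ` A"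
    using assms unfolding monomials_def by (rule subset_imageE)
  show thesis
    by (rule that[OF A]) (simp add: A ideal_gen_single_image)
qed

lemma monomial_idealE:
  assumes "monomial_ideal I"
  obtains X where "up_closed X" and "I = monomial_span X"
proof -
  obtain S where S: "S \<subseteq> monomials" "I = ideal_gen S"
    using assms by (auto simp: monomial_ideal_def)
  obtain A where "ideal_gen S = monomial_span (A + UNIV)"
    using S(1) by (rule ideal_gen_monomialsE)
  then show thesis
    using that S(2) up_closed_plus[OF up_closed_UNIV] by blast
qed

lemma monomial_span_eq_ideal_gen:
  "up_closed X \<Longrightarrow>
    monomial_span X = ideal_gen ((\<lambda>a. Poly_Mapping.single a (1::'k::comm_ring_1)) ` X)"
  by (simp add: ideal_gen_single_image up_closed_plus_UNIV)

lemma is_ideal_monomial_span: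
  "up_closed X \<Longrightarrow> is_ideal (monomial_span X :: ('n, 'k::comm_ring_1) mpoly set)"
  by (simp add: monomial_span_eq_ideal_gen is_ideal_def ideal_gen_def)

text \<open>
  The exponents of a product of polynomials are among the sums of their exponents, and
  since \<open>x^(a + b) = x^a * x^b\<close>, each such sum occurs as the exponent of a product of monomials.
\<close>

lemma ideal_mult_monomial_span:
  fixes X Y :: "('n \<Rightarrow>\<^sub>0 nat) set"
  assumes Y: "up_closed Y"
  shows "ideal_mult (monomial_span X) (monomial_span Y) =
    (monomial_span (X + Y) :: ('n, 'k::comm_ring_1) mpoly set)"
    (is "ideal_mult ?I ?J = ?IJ")
proof
  have "is_ideal ?IJ"
    using Y by (intro is_ideal_monomial_span up_closed_plus)
  moreover have "f * g \<in> ?IJ" if "f \<in> ?I" "g \<in> ?J" for f g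
    using that keys_mult[of f g] by (fastforce simp: monomial_span_def set_plus_def)
  ultimately show "ideal_mult ?I ?J \<subseteq> ?IJ"
    unfolding ideal_mult_def ideal_gen_def is_ideal_def
    by (intro ideal.span_minimal) auto
next
  have "Poly_Mapping.single c 1 \<in> ideal_mult ?I ?J" if c: "c \<in> X + Y" for c
  proof -
    obtain a b where ab: "a \<in> X" "b \<in> Y" "c = a + b"
      using c by (auto simp: set_plus_def)
    then have "Poly_Mapping.single c (1::'k) = Poly_Mapping.single a 1 * Poly_Mapping.single b 1"
      by (simp add: mult_single)
    then show ?thesis
      unfolding ideal_mult_def
      using ab single_one_in_monomial_span_iff by (intro ideal_gen_base) blast
  qed
  then show "?IJ \<subseteq> ideal_mult ?I ?J"
    unfolding monomial_span_eq_ideal_gen[OF up_closed_plus[OF Y]]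
    unfolding ideal_gen_def ideal_mult_def by (intro ideal.span_minimal) auto
qed


section \<open>Demotions in terms of exponent vectors\<close>

text \<open>
  The iterated sum starts from all exponent vectors, the exponent set of the unit ideal, so that
  it matches powers of ideals.
\<close>

primrec exp_pow :: "'a::plus set \<Rightarrow> nat \<Rightarrow> 'a set" where
  "exp_pow X 0 = UNIV"
| "exp_pow X (Suc r) = X + exp_pow X r"

definition exp_demotion :: "'a::plus set \<Rightarrow> 'a set \<Rightarrow> bool" where
  "exp_demotion Y X \<longleftrightarrow> Y \<subseteq> X \<and>
     (\<forall>r s. exp_pow X r + exp_pow Y s = exp_pow X (r + s) \<inter> exp_pow Y s)"

lemma up_closed_exp_pow: "up_closed (exp_pow (X :: 'a::comm_monoid_add set) r)"
  by (induction r) (simp_all add: up_closed_UNIV up_closed_plus)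

lemma ideal_pow_monomial_span: "ideal_pow (monomial_span X) r = monomial_span (exp_pow X r)"
  by (induction r)
    (simp_all add: monomial_span_UNIV ideal_mult_monomial_span up_closed_exp_pow)

lemma demotion_monomial_span_iff:
  assumes "up_closed X" "up_closed Y"
  shows "demotion (monomial_span Y :: ('n, 'k::comm_ring_1) mpoly set) (monomial_span X)
    \<longleftrightarrow> exp_demotion Y X"
  using assms
  by (simp add: demotion_def exp_demotion_def is_ideal_monomial_span monomial_span_subset_iff
      ideal_pow_monomial_span ideal_mult_monomial_span up_closed_exp_pow
      monomial_span_eq_iff flip: monomial_span_Int)


section \<open>Scaling and rounded division of exponent vectors\<close>

definition exp_scale :: "('n \<Rightarrow> nat) \<Rightarrow> ('n \<Rightarrow>\<^sub>0 nat) \<Rightarrow> ('n \<Rightarrow>\<^sub>0 nat)" where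
  "exp_scale W a = Poly_Mapping.mapp (\<lambda>i k. W i * k) a"

definition exp_div :: "('n \<Rightarrow> nat) \<Rightarrow> ('n \<Rightarrow>\<^sub>0 nat) \<Rightarrow> ('n \<Rightarrow>\<^sub>0 nat)" where
  "exp_div W a = Poly_Mapping.mapp (\<lambda>i k. k div W i) a"

lemma lookup_exp_scale: "Poly_Mapping.lookup (exp_scale W a) i = W i * Poly_Mapping.lookup a i"
  by (simp add: exp_scale_def lookup_mapp when_def in_keys_iff)

lemma lookup_exp_div: "Poly_Mapping.lookup (exp_div W a) i = Poly_Mapping.lookup a i div W i"
  by (simp add: exp_div_def lookup_mapp when_def in_keys_iff)

lemma exp_scale_add: "exp_scale W (a + b) = exp_scale W a + exp_scale W b"
  by (rule poly_mapping_eqI) (simp add: lookup_exp_scale lookup_add algebra_simps)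

lemma exp_div_exp_scale_add:
  assumes "is_weight W"
  shows "exp_div W (exp_scale W a + r) = a + exp_div W r"
  using assms by (intro poly_mapping_eqI)
    (simp add: lookup_exp_div lookup_exp_scale lookup_add is_weight_def)

lemma exp_div_exp_scale: "is_weight W \<Longrightarrow> exp_div W (exp_scale W a) = a"
  using exp_div_exp_scale_add[of W a 0] by (simp add: exp_div_def mapp_def)

lemma surj_exp_div: "is_weight W \<Longrightarrow> surj (exp_div W)"
  by (rule surjI) (rule exp_div_exp_scale)

lemma exp_div_remainderE:
  obtains r where "c = exp_scale W (exp_div W c) + r"
proof
  show "c = exp_scale W (exp_div W c) + (c - exp_scale W (exp_div W c))"
    by (rule poly_mapping_eqI)
      (simp add: lookup_exp_div lookup_exp_scale lookup_add lookup_minus)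
qed

text \<open>
  The adjunction between scaling and rounded division: \<open>c\<close> lies above the scaled \<open>a\<close> iff its
  quotient lies above \<open>a\<close>.
\<close>

lemma exp_scale_image_plus_UNIV:
  assumes W: "is_weight W"
  shows "exp_scale W ` A + UNIV = exp_div W -` (A + UNIV)"
proof (intro set_eqI iffI)
  fix c assume "c \<in> exp_scale W ` A + UNIV"
  then show "c \<in> exp_div W -` (A + UNIV)"
    using exp_div_exp_scale_add[OF W] by (fastforce simp: set_plus_def)
next
  fix c assume "c \<in> exp_div W -` (A + UNIV)"
  then obtain a b where ab: "a \<in> A" "exp_div W c = a + b"
    by (auto simp: set_plus_def)
  obtain r where "c = exp_scale W (exp_div W c) + r"
    by (rule exp_div_remainderE)
  then have "c = exp_scale W a + (exp_scale W b + r)"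
    by (simp add: ab exp_scale_add add.assoc)
  then show "c \<in> exp_scale W ` A + UNIV"
    using ab by (auto simp: set_plus_def)
qed

lemma up_closed_vimage_exp_div:
  assumes W: "is_weight W" and X: "up_closed X"
  shows "up_closed (exp_div W -` X)"
proof -
  have "exp_div W -` X = exp_scale W ` X + UNIV"
    by (simp add: exp_scale_image_plus_UNIV[OF W] up_closed_plus_UNIV[OF X])
  then show ?thesis
    by (simp add: up_closed_plus up_closed_UNIV)
qed

text \<open>
  The remainders of \<open>a\<close> and \<open>b\<close> can add up to a carry, so the quotient of \<open>a + b\<close> can exceed the
  sum of their quotients; \<open>Y\<close> absorbs this excess because it is closed upwards.  Conversely, if
  the quotient of \<open>c\<close> is \<open>x + y\<close>, then \<open>c\<close> splits into the scaled \<open>x\<close>, whose quotient is \<open>x\<close>, and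
  the scaled \<open>y\<close> plus the remainder of \<open>c\<close>, whose quotient lies above \<open>y\<close>.
\<close>

lemma vimage_exp_div_plus:
  assumes W: "is_weight W" and Y: "up_closed Y"
  shows "exp_div W -` (X + Y) = exp_div W -` X + exp_div W -` Y"
proof (intro set_eqI iffI)
  fix c assume "c \<in> exp_div W -` (X + Y)"
  then obtain x y where xy: "x \<in> X" "y \<in> Y" "exp_div W c = x + y"
    by (auto simp: set_plus_def)
  obtain r where "c = exp_scale W (exp_div W c) + r"
    by (rule exp_div_remainderE)
  then have "c = exp_scale W x + (exp_scale W y + r)"
    by (simp add: xy exp_scale_add add.assoc)
  moreover have "exp_div W (exp_scale W x) \<in> X"
    using xy by (simp add: exp_div_exp_scale[OF W])
  moreover have "exp_div W (exp_scale W y + r) \<in> Y"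
    using xy Y by (simp add: exp_div_exp_scale_add[OF W] up_closed_def)
  ultimately show "c \<in> exp_div W -` X + exp_div W -` Y"
    by (auto simp: set_plus_def)
next
  fix c assume "c \<in> exp_div W -` X + exp_div W -` Y"
  then obtain a b where ab: "exp_div W a \<in> X" "exp_div W b \<in> Y" "c = a + b"
    by (auto simp: set_plus_def)
  obtain r where r: "a = exp_scale W (exp_div W a) + r"
    by (rule exp_div_remainderE)
  obtain s where s: "b = exp_scale W (exp_div W b) + s"
    by (rule exp_div_remainderE)
  have "c = exp_scale W (exp_div W a + exp_div W b) + (r + s)"
    unfolding ab(3) by (subst r, subst s) (simp add: exp_scale_add ac_simps)
  then have "exp_div W c = exp_div W a + (exp_div W b + exp_div W (r + s))"
    by (simp add: exp_div_exp_scale_add[OF W] add.assoc)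
  then show "c \<in> exp_div W -` (X + Y)"
    using ab Y by (auto simp: set_plus_def up_closed_def)
qed

lemma exp_pow_vimage_exp_div:
  assumes "is_weight W"
  shows "exp_pow (exp_div W -` X) r = exp_div W -` exp_pow X r"
  by (induction r) (simp_all add: vimage_exp_div_plus[OF assms] up_closed_exp_pow)

lemma exp_demotion_vimage_exp_div_iff:
  assumes W: "is_weight W"
  shows "exp_demotion (exp_div W -` Y) (exp_div W -` X) \<longleftrightarrow> exp_demotion Y X"
proof -
  have subset: "exp_div W -` A \<subseteq> exp_div W -` B \<longleftrightarrow> A \<subseteq> B" for A B
    using image_mono[of "exp_div W -` A" "exp_div W -` B" "exp_div W"]
    by (auto simp: surj_exp_div[OF W])
  have eq: "exp_div W -` A = exp_div W -` B \<longleftrightarrow> A = B" for A B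
    by (simp add: set_eq_subset subset)
  show ?thesis
    by (simp add: exp_demotion_def exp_pow_vimage_exp_div[OF W] up_closed_exp_pow subset eq
        flip: vimage_exp_div_plus[OF W] vimage_Int)
qed


section \<open>Exponent vectors of weighted ideals\<close>

lemma weight_hom_single:
  fixes W :: "'n \<Rightarrow> nat"
  shows "weight_hom W (Poly_Mapping.single a (1::'k::comm_ring_1)) =
    Poly_Mapping.single (exp_scale W a) 1"
proof -
  let ?h = "weight_hom W :: ('n, 'k) mpoly \<Rightarrow> ('n, 'k) mpoly"
  have h: "algebra_hom ?h \<and> (\<forall>i. ?h (Var i) = Var i ^ W i)"
    unfolding weight_hom_def by (rule theI'[OF ex1_weight_hom])
  then have mult: "?h (f * g) = ?h f * ?h g" for f g
    by (simp add: algebra_hom_def)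
  have "?h (Const 1) = Const 1"
    using h by (simp add: algebra_hom_def)
  then have one: "?h 1 = 1"
    by (simp add: Const_def)
  have scale_0: "exp_scale W 0 = 0"
    by (rule poly_mapping_eqI) (simp add: lookup_exp_scale)
  have scale_single:
    "exp_scale W (Poly_Mapping.single i k) = Poly_Mapping.single i (W i * k)" for i k
    by (rule poly_mapping_eqI) (simp add: lookup_exp_scale lookup_single when_def)
  have pow: "?h (Var i ^ k) = (Var i ^ W i) ^ k" for i k
    by (induction k) (use h one mult in simp_all)
  show ?thesis
  proof (induction a rule: poly_mapping_single_induct)
    case zero
    then show ?case by (simp add: one scale_0)
  next
    case (single i k)
    then show ?case
      by (simp add: scale_single pow power_mult flip: Var_power)
  next
    case (add a b)
    have "Poly_Mapping.single (a + b) (1::'k) =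
        Poly_Mapping.single a 1 * Poly_Mapping.single b 1"
      by (simp add: mult_single)
    then show ?case
      by (simp only: mult add) (simp add: exp_scale_add mult_single)
  qed
qed

text \<open>
  Whatever monomials generate the ideal, their exponents \<open>A\<close> satisfy \<open>X = A + UNIV\<close>.  The exponent
  set of the weighted ideal is then \<open>exp_scale W ` A + UNIV\<close>, which is the preimage of \<open>A + UNIV\<close>
  by the adjunction between scaling and rounded division.
\<close>

lemma weighted_ideal_monomial_span:
  fixes X :: "('n::finite \<Rightarrow>\<^sub>0 nat) set"
  assumes W: "is_weight W" and X: "up_closed X"
  shows "weighted_ideal W (monomial_span X :: ('n, 'k::field) mpoly set) =
    monomial_span (exp_div W -` X)"
proof -
  let ?I = "monomial_span X :: ('n, 'k) mpoly set"
  let ?x = "\<lambda>a. Poly_Mapping.single a (1::'k)"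
  have "monomial_ideal ?I"
    unfolding monomial_ideal_def
    by (rule exI[of _ "?x ` X"])
      (auto simp: monomials_def monomial_span_eq_ideal_gen[OF X])
  then have "is_min_mono_gens ?I (min_mono_gens ?I)"
    unfolding min_mono_gens_def by (rule theI'[OF ex1_min_mono_gens])
  then have mono: "min_mono_gens ?I \<subseteq> monomials" and gen: "ideal_gen (min_mono_gens ?I) = ?I"
    by (auto simp: is_min_mono_gens_def)
  obtain A where A: "min_mono_gens ?I = ?x ` A"
    and span: "ideal_gen (min_mono_gens ?I) = monomial_span (A + UNIV)"
    using mono by (rule ideal_gen_monomialsE)
  then have XA: "X = A + UNIV"
    using trans[OF gen[symmetric] span] by (simp add: monomial_span_eq_iff)
  have "weight_hom W ` min_mono_gens ?I = ?x ` (exp_scale W ` A)"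
    by (simp add: A image_image weight_hom_single)
  then show ?thesis
    by (simp add: weighted_ideal_def ideal_gen_single_image exp_scale_image_plus_UNIV[OF W] XA)
qed

theorem proposition5p15:
  fixes I J :: "('n::finite, 'k::field) mpoly set"
    and W :: "'n \<Rightarrow> nat"
  assumes "monomial_ideal I" and "monomial_ideal J"
    and "is_weight W"
  shows "demotion J I \<longleftrightarrow> demotion (weighted_ideal W J) (weighted_ideal W I)"
proof -
  obtain X where X: "up_closed X" "I = monomial_span X"
    using assms(1) by (rule monomial_idealE)
  obtain Y where Y: "up_closed Y" "J = monomial_span Y"
    using assms(2) by (rule monomial_idealE)
  show ?thesis
    using X Y assms(3)
    by (simp add: weighted_ideal_monomial_span demotion_monomial_span_iff
        up_closed_vimage_exp_div exp_demotion_vimage_exp_div_iff)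
qed

end
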